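(* Let $K$ be a pure $r$-dimensional simplicial complex on $n$ vertices containing no $r$-dimensional wheel. Then $\mathfrak{q}_{r-1}(K)\le n$. Furthermore, if $K$ is $r$-path connected, then $\mathfrak{q}_{r-1}(K)=n$ if and only if $K$ is $1$-neighbor uniform.
   Context: A simplicial complex is a family of subsets of a vertex set closed under taking subsets; an $i$-face has size $i+1$; $S_i(K)$ is the set of $i$-faces; pure $r$-dimensional means all maximal faces are $r$-faces. $\mathfrak{q}_{r-1}(K)$ is the spectral radius of $BB^\top$, where $B$ is the $0/1$ incidence matrix with rows indexed by $S_{r-1}(K)$, columns by $S_r(K)$, $B_{G,F}=1$ iff $G\subset F$ (equivalently the spectral radius of $B^\top B$, acting on functions on $S_r(K)$ by $(B^\top Bf)(F)=(r+1)f(F)+\sum f(F')$ over $r$-faces $F'\ne F$ with $|F\cap F'|=r$). $K$ contains an $r$-dimensional wheel if there exist an $(r-1)$-set $S$ of vertices and distinct vertices $v_1,\dots,v_k\notin S$, $k\ge3$, with $S\cup\{v_i,v_{i+1}\}\in S_r(K)$ for all $i$ (indices mod $k$). An $r$-path is a sequence of $r$-faces $F_1,\dots,F_m$ with $F_i\cap F_j$ an $(r-1)$-face iff $|i-j|=1$; $K$ is $r$-path connected if any two $r$-faces are joined by an $r$-path. For an $r$-face $F$ and vertex $u\notin F$, $N^{\mathrm d}(F,u)=\{G\cup\{u\}\in S_r(K): G\subset F,\ |G|=r\}$; $K$ is $1$-neighbor uniform if $|N^{\mathrm d}(F,u)|=1$ for every $r$-face $F$ and vertex $u\notin F$. *)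

theory Defs
  imports "Jordan_Normal_Form.Spectral_Radius"
begin

definition simplicial_complex :: "'a set \<Rightarrow> 'a set set \<Rightarrow> bool" where
  "simplicial_complex V K \<longleftrightarrow>
     finite V \<and> K \<subseteq> Pow V \<and> (\<forall>F\<in>K. \<forall>G. G \<subseteq> F \<longrightarrow> G \<in> K)"

definition faces :: "nat \<Rightarrow> 'a set set \<Rightarrow> 'a set set" where
  "faces i K = {F \<in> K. card F = i + 1}"

text \<open>Being \<open>r\<close>-dimensional includes having an \<open>r\<close>-face; this excludes the empty family,
  for which the condition on maximal faces is vacuous.\<close>

definition pure_dim :: "nat \<Rightarrow> 'a set set \<Rightarrow> bool" where
  "pure_dim r K \<longleftrightarrow>
     faces r K \<noteq> {} \<and> (\<forall>M\<in>K. (\<forall>F\<in>K. \<not> M \<subset> F) \<longrightarrow> M \<in> faces r K)"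

text \<open>Library matrices are indexed by initial segments of the naturals, so the faces are
  enumerated in an arbitrary order. Other choices permute the rows and columns of the incidence
  matrix \<open>B\<close>, which does not change the spectrum of \<open>B B\<^sup>T\<close>.\<close>

definition face_list :: "nat \<Rightarrow> 'a set set \<Rightarrow> 'a set list" where
  "face_list i K = (SOME xs. distinct xs \<and> set xs = faces i K)"

definition incidence_mat :: "nat \<Rightarrow> 'a set set \<Rightarrow> complex mat" where
  "incidence_mat i K =
     mat (card (faces i K)) (card (faces (Suc i) K))
       (\<lambda>(a, b). if face_list i K ! a \<subset> face_list (Suc i) K ! b then 1 else 0)"

definition signless_radius :: "nat \<Rightarrow> 'a set set \<Rightarrow> real" where
  "signless_radius i K =
     spectral_radius (incidence_mat i K * transpose_mat (incidence_mat i K))"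

definition contains_wheel :: "nat \<Rightarrow> 'a set \<Rightarrow> 'a set set \<Rightarrow> bool" where
  "contains_wheel r V K \<longleftrightarrow>
     (\<exists>S k v. S \<subseteq> V \<and> card S = r - 1 \<and> k \<ge> 3 \<and> inj_on v {..<k} \<and>
        (\<forall>i<k. v i \<in> V - S) \<and>
        (\<forall>i<k. S \<union> {v i, v (Suc i mod k)} \<in> faces r K))"

definition r_path :: "nat \<Rightarrow> 'a set set \<Rightarrow> 'a set list \<Rightarrow> bool" where
  "r_path r K Fs \<longleftrightarrow>
     Fs \<noteq> [] \<and> set Fs \<subseteq> faces r K \<and>
     (\<forall>i<length Fs. \<forall>j<length Fs.
        Fs ! i \<inter> Fs ! j \<in> faces (r - 1) K \<longleftrightarrow> \<bar>int i - int j\<bar> = 1)"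

definition r_path_connected :: "nat \<Rightarrow> 'a set set \<Rightarrow> bool" where
  "r_path_connected r K \<longleftrightarrow>
     (\<forall>F\<in>faces r K. \<forall>F'\<in>faces r K. \<exists>Fs. r_path r K Fs \<and> hd Fs = F \<and> last Fs = F')"

definition down_neighbors :: "nat \<Rightarrow> 'a set set \<Rightarrow> 'a set \<Rightarrow> 'a \<Rightarrow> 'a set set" where
  "down_neighbors r K F u = {G \<union> {u} | G. G \<subseteq> F \<and> card G = r \<and> G \<union> {u} \<in> faces r K}"

definition one_neighbor_uniform :: "nat \<Rightarrow> 'a set \<Rightarrow> 'a set set \<Rightarrow> bool" where
  "one_neighbor_uniform r V K \<longleftrightarrow>
     (\<forall>F\<in>faces r K. \<forall>u\<in>V - F. card (down_neighbors r K F u) = 1)"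

end

theory Submission
  imports Defs
begin

text \<open>If some vertex \<open>u \<notin> F\<close> had two down-neighbours \<open>F - {a} \<union> {u}\<close> and \<open>F - {b} \<union> {u}\<close>, then
  \<open>F - {a, b}\<close> together with \<open>a, b, u\<close> would be a wheel with \<open>k = 3\<close>. Hence every row of \<open>B\<^sup>T B\<close>
  sums to at most \<open>(r + 1) + (n - r - 1) = n\<close>, which bounds the spectral radius. Equality holds
  for all rows iff \<open>K\<close> is 1-neighbor uniform, and then the constant function is an eigenvector for
  \<open>n\<close>. Conversely, if an eigenvalue has modulus \<open>n\<close>, the set of \<open>r\<close>-faces at which the eigenfunction
  has maximal modulus is closed under adjacency, and all rows at these faces sum to \<open>n\<close>.\<close>

section \<open>Eigenvalues of \<open>B B^T\<close> in terms of functions on faces\<close>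

lemma face_list:
  assumes "finite K"
  shows "distinct (face_list i K)" "set (face_list i K) = faces i K"
proof -
  have "finite (faces i K)" using assms by (simp add: faces_def)
  then have "\<exists>xs. distinct xs \<and> set xs = faces i K" using finite_distinct_list by blast
  then have "distinct (face_list i K) \<and> set (face_list i K) = faces i K"
    unfolding face_list_def by (rule someI_ex)
  then show "distinct (face_list i K)" "set (face_list i K) = faces i K" by auto
qed

lemma bij_betw_face_list:
  assumes "finite K"
  shows "bij_betw ((!) (face_list i K)) {..<card (faces i K)} (faces i K)"
  using face_list[OF assms, of i] by (intro bij_betw_nth) (auto simp: distinct_card[symmetric])

text \<open>Removes the enumeration from the action of \<open>B B^T\<close>: applying the transpose
  first and then \<open>B\<close>, each product is a sum over indices that \<open>face_list\<close>
  reindexes as a sum over faces.\<close>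

lemma incidence_gram_mult_vec:
  assumes K: "finite K" and a: "a < card (faces i K)"
  shows "((incidence_mat i K * transpose_mat (incidence_mat i K)) *\<^sub>v
      vec (card (faces i K)) (\<lambda>c. g (face_list i K ! c))) $ a =
    (\<Sum>F | F \<in> faces (Suc i) K \<and> face_list i K ! a \<subset> F. \<Sum>G | G \<in> faces i K \<and> G \<subset> F. g G)"
proof -
  let ?m = "card (faces i K)" and ?p = "card (faces (Suc i) K)"
  let ?B = "incidence_mat i K" and ?xs = "face_list i K" and ?ys = "face_list (Suc i) K"
  let ?v = "vec ?m (\<lambda>c. g (?xs ! c))"
  have fin: "finite (faces j K)" for j using K by (simp add: faces_def)
  have B: "?B \<in> carrier_mat ?m ?p" by (simp add: incidence_mat_def)
  have Bt: "transpose_mat ?B \<in> carrier_mat ?p ?m" using B by simp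
  have inner: "(transpose_mat ?B *\<^sub>v ?v) $ b = (\<Sum>G | G \<in> faces i K \<and> G \<subset> ?ys ! b. g G)"
    if b: "b < ?p" for b
  proof -
    have "(transpose_mat ?B *\<^sub>v ?v) $ b =
        (\<Sum>c<?m. if ?xs ! c \<subset> ?ys ! b then g (?xs ! c) else 0)"
      using b by (auto simp: incidence_mat_def scalar_prod_def atLeast0LessThan intro!: sum.cong)
    also have "\<dots> = (\<Sum>G\<in>faces i K. if G \<subset> ?ys ! b then g G else 0)"
      by (rule sum.reindex_bij_betw[OF bij_betw_face_list[OF K]])
    finally show ?thesis using fin by (simp add: sum.inter_filter)
  qed
  have "(?B * transpose_mat ?B) *\<^sub>v ?v = ?B *\<^sub>v (transpose_mat ?B *\<^sub>v ?v)"
    using B Bt by (intro assoc_mult_mat_vec) auto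
  also have "\<dots> $ a = (\<Sum>b<?p. if ?xs ! a \<subset> ?ys ! b then (transpose_mat ?B *\<^sub>v ?v) $ b else 0)"
    using a by (subst index_mult_mat_vec)
      (auto simp: incidence_mat_def scalar_prod_def atLeast0LessThan intro!: sum.cong)
  also have "\<dots> = (\<Sum>b<?p. if ?xs ! a \<subset> ?ys ! b
      then \<Sum>G | G \<in> faces i K \<and> G \<subset> ?ys ! b. g G else 0)"
    by (rule sum.cong) (auto simp: inner)
  also have "\<dots> = (\<Sum>F\<in>faces (Suc i) K. if ?xs ! a \<subset> F
      then \<Sum>G | G \<in> faces i K \<and> G \<subset> F. g G else 0)"
    by (rule sum.reindex_bij_betw[OF bij_betw_face_list[OF K]])
  finally show ?thesis unfolding sum.inter_filter[OF fin, where P = "\<lambda>F. face_list i K ! a \<subset> F", symmetric] .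
qed

text \<open>Every vector of the right dimension lists the values of some function on faces along the
  enumeration, so eigenvectors and nonzero eigenfunctions correspond. From here on no matrix entries
  are needed.\<close>

lemma eigenvalue_incidence_gram_iff:
  assumes K: "finite K"
  shows "eigenvalue (incidence_mat i K * transpose_mat (incidence_mat i K)) k \<longleftrightarrow>
    (\<exists>g. (\<exists>G\<in>faces i K. g G \<noteq> 0) \<and>
      (\<forall>G\<in>faces i K. (\<Sum>F | F \<in> faces (Suc i) K \<and> G \<subset> F.
        \<Sum>G' | G' \<in> faces i K \<and> G' \<subset> F. g G') = k * g G))"
    (is "eigenvalue ?A k \<longleftrightarrow> (\<exists>g. ?P g)")
proof -
  let ?m = "card (faces i K)" and ?xs = "face_list i K"
  have dim: "dim_row ?A = ?m" by (simp add: incidence_mat_def)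
  note bij = bij_betw_face_list[OF K, of i]
  have all_faces: "(\<forall>G\<in>faces i K. P G) \<longleftrightarrow> (\<forall>a<?m. P (?xs ! a))" for P
    using bij unfolding bij_betw_def by (metis imageE imageI lessThan_iff)
  have key: "eigenvector ?A (vec ?m (\<lambda>c. g (?xs ! c))) k \<longleftrightarrow> ?P g" for g
  proof -
    have "vec ?m (\<lambda>c. g (?xs ! c)) \<noteq> 0\<^sub>v ?m \<longleftrightarrow> \<not> (\<forall>G\<in>faces i K. g G = 0)"
      unfolding all_faces by (auto simp: vec_eq_iff)
    moreover have "?A *\<^sub>v vec ?m (\<lambda>c. g (?xs ! c)) = k \<cdot>\<^sub>v vec ?m (\<lambda>c. g (?xs ! c)) \<longleftrightarrow>
      (\<forall>a<?m. (?A *\<^sub>v vec ?m (\<lambda>c. g (?xs ! c))) $ a = k * g (?xs ! a))"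
      unfolding vec_eq_iff using dim by (simp del: index_mult_mat_vec)
    moreover have "\<dots> \<longleftrightarrow> (\<forall>G\<in>faces i K. (\<Sum>F | F \<in> faces (Suc i) K \<and> G \<subset> F.
        \<Sum>G' | G' \<in> faces i K \<and> G' \<subset> F. g G') = k * g G)"
      unfolding all_faces by (simp add: incidence_gram_mult_vec[OF K] del: index_mult_mat_vec)
    ultimately show ?thesis unfolding eigenvector_def dim by simp
  qed
  show ?thesis
  proof
    assume "eigenvalue ?A k"
    then obtain v where v: "eigenvector ?A v k" by (auto simp: eigenvalue_def)
    from v have "dim_vec v = ?m" unfolding eigenvector_def dim by simp
    define g where "g G = v $ inv_into {..<?m} ((!) ?xs) G" for G
    have "vec ?m (\<lambda>c. g (?xs ! c)) = v"
      using bij \<open>dim_vec v = ?m\<close> by (intro eq_vecI) (auto simp: g_def bij_betw_def inv_into_f_f)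
    then have "?P g" using v key[of g] by simp
    then show "\<exists>g. ?P g" by blast
  next
    assume "\<exists>g. ?P g"
    then show "eigenvalue ?A k" using key by (auto simp: eigenvalue_def)
  qed
qed

section \<open>Adjacency of faces and the effect of wheels\<close>

text \<open>The off-diagonal support of row \<open>F\<close> of \<open>B^T B\<close>. An
  \<open>r\<close>-face \<open>F\<close> is not adjacent to itself, since it has
  \<open>r + 1\<close> vertices.\<close>

definition adjacent_faces :: "nat \<Rightarrow> 'a set set \<Rightarrow> 'a set \<Rightarrow> 'a set set" where
  "adjacent_faces r K F = {F' \<in> faces r K. card (F \<inter> F') = r}"

text \<open>The parameter \<open>i\<close> stands for \<open>r - 1\<close>, which avoids truncated
  subtraction.\<close>

locale complex_on =
  fixes V :: "'a set" and K :: "'a set set" and i :: nat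
  assumes complex: "simplicial_complex V K"
begin

lemma finite_V: "finite V"
  using complex by (simp add: simplicial_complex_def)

lemma finite_K: "finite K"
  using complex by (auto simp: simplicial_complex_def intro: finite_subset)

lemma finite_faces: "finite (faces j K)"
  using finite_K by (simp add: faces_def)

lemma face_subset: "F \<in> faces j K \<Longrightarrow> F \<subseteq> V"
  using complex by (auto simp: simplicial_complex_def faces_def)

lemma finite_face: "F \<in> faces j K \<Longrightarrow> finite F"
  using face_subset finite_V finite_subset by blast

lemma card_face: "F \<in> faces j K \<Longrightarrow> card F = j + 1"
  by (simp add: faces_def)

lemma subset_face: "F \<in> faces j K \<Longrightarrow> G \<subseteq> F \<Longrightarrow> card G = l + 1 \<Longrightarrow> G \<in> faces l K"
  using complex by (auto simp: simplicial_complex_def faces_def)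

lemma card_Int_face:
  assumes "F \<in> faces j K" "F' \<in> faces j K" "F \<noteq> F'"
  shows "card (F \<inter> F') \<le> j"
proof -
  have "F \<inter> F' \<noteq> F"
    using assms card_face finite_face by (metis Int_lower2 card_subset_eq)
  then have "F \<inter> F' \<subset> F" by blast
  then have "card (F \<inter> F') < card F" using finite_face[OF assms(1)] by (rule psubset_card_mono[rotated])
  then show ?thesis using card_face[OF assms(1)] by simp
qed

text \<open>This is the action of \<open>B^T B\<close>. After swapping the sums, \<open>h F'\<close>
  is counted once for each common \<open>i\<close>-face of \<open>F\<close> and \<open>F'\<close>,
  that is \<open>card (F \<inter> F') choose Suc i\<close> times: \<open>i + 2\<close> times for
  \<open>F' = F\<close>, once for an adjacent face, and never otherwise.\<close>

lemma sum_common_subfaces: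
  fixes h :: "'a set \<Rightarrow> 'b::comm_ring_1"
  assumes F: "F \<in> faces (Suc i) K"
  shows "(\<Sum>G | G \<in> faces i K \<and> G \<subset> F. \<Sum>F' | F' \<in> faces (Suc i) K \<and> G \<subset> F'. h F') =
    of_nat (i + 2) * h F + (\<Sum>F'\<in>adjacent_faces (Suc i) K F. h F')"
proof -
  let ?Fs = "faces (Suc i) K" and ?N = "adjacent_faces (Suc i) K F"
  have count: "card {G \<in> {G \<in> faces i K. G \<subset> F}. G \<subset> F'} = card (F \<inter> F') choose (Suc i)"
    if F': "F' \<in> ?Fs" for F'
  proof -
    have "{G \<in> {G \<in> faces i K. G \<subset> F}. G \<subset> F'} = {G. G \<subseteq> F \<inter> F' \<and> card G = Suc i}"
    proof (intro equalityI subsetI)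
      fix G assume "G \<in> {G. G \<subseteq> F \<inter> F' \<and> card G = Suc i}"
      then have G: "G \<subseteq> F" "G \<subseteq> F'" "card G = i + 1" by auto
      \<comment> \<open>The sizes \<open>i + 1\<close> and \<open>i + 2\<close> differ, so the
        inclusions are automatically strict.\<close>
      moreover from this have "G \<noteq> F" "G \<noteq> F'" using card_face[OF F] card_face[OF F'] by auto
      ultimately show "G \<in> {G \<in> {G \<in> faces i K. G \<subset> F}. G \<subset> F'}"
        using subset_face[OF F] by blast
    qed (auto simp: card_face)
    then show ?thesis using n_subsets[of "F \<inter> F'" "Suc i"] finite_face[OF F] by (metis finite_Int)
  qed
  have "(\<Sum>G | G \<in> faces i K \<and> G \<subset> F. \<Sum>F' | F' \<in> ?Fs \<and> G \<subset> F'. h F') =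
      (\<Sum>F'\<in>?Fs. \<Sum>G | G \<in> {G \<in> faces i K. G \<subset> F} \<and> G \<subset> F'. h F')"
    using finite_faces by (intro sum.swap_restrict) auto
  also have "\<dots> = (\<Sum>F'\<in>?Fs. of_nat (card (F \<inter> F') choose (Suc i)) * h F')"
    by (rule sum.cong) (use count in auto)
  also have "\<dots> = (\<Sum>F'\<in>insert F ?N. of_nat (card (F \<inter> F') choose (Suc i)) * h F')"
  proof (rule sum.mono_neutral_right)
    show "\<forall>F'\<in>?Fs - insert F ?N. of_nat (card (F \<inter> F') choose (Suc i)) * h F' = 0"
    proof
      fix F' assume F': "F' \<in> ?Fs - insert F ?N"
      then have "card (F \<inter> F') \<le> Suc i" using card_Int_face[OF F] by blast
      with F' have "card (F \<inter> F') < Suc i" by (auto simp: adjacent_faces_def)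
      then show "of_nat (card (F \<inter> F') choose (Suc i)) * h F' = 0" by (simp add: binomial_eq_0)
    qed
  qed (use F finite_faces in \<open>auto simp: adjacent_faces_def\<close>)
  also have "\<dots> = of_nat (i + 2) * h F + (\<Sum>F'\<in>?N. of_nat (card (F \<inter> F') choose (Suc i)) * h F')"
    using F finite_faces card_face[OF F] by (subst sum.insert) (auto simp: adjacent_faces_def)
  also have "(\<Sum>F'\<in>?N. of_nat (card (F \<inter> F') choose (Suc i)) * h F') = (\<Sum>F'\<in>?N. h F')"
    by (rule sum.cong) (auto simp: adjacent_faces_def)
  finally show ?thesis .
qed

text \<open>An adjacent face has exactly one vertex outside \<open>F\<close>; sorting the adjacent
  faces by this vertex partitions them into the sets of down-neighbours.\<close>

lemma card_adjacent_faces: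
  assumes F: "F \<in> faces r K"
  shows "card (adjacent_faces r K F) = (\<Sum>u\<in>V - F. card (down_neighbors r K F u))"
proof -
  have "adjacent_faces r K F = (\<Union>u\<in>V - F. down_neighbors r K F u)"
  proof
    show "adjacent_faces r K F \<subseteq> (\<Union>u\<in>V - F. down_neighbors r K F u)"
    proof
      fix F' assume "F' \<in> adjacent_faces r K F"
      then have F': "F' \<in> faces r K" and c: "card (F \<inter> F') = r" by (auto simp: adjacent_faces_def)
      have "card (F' - F) = 1"
        using card_Diff_subset_Int[of F' F] F' c finite_face card_face by (simp add: Int_commute)
      then obtain u where u: "F' - F = {u}" by (auto simp: card_1_singleton_iff)
      have F'_eq: "F' = F \<inter> F' \<union> {u}" using u by blast
      have "F' \<in> down_neighbors r K F u"
        unfolding down_neighbors_def using F' c F'_eq by (intro CollectI exI[of _ "F \<inter> F'"]) auto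
      moreover have "u \<in> V - F" using u face_subset[OF F'] by blast
      ultimately show "F' \<in> (\<Union>u\<in>V - F. down_neighbors r K F u)" by blast
    qed
    show "(\<Union>u\<in>V - F. down_neighbors r K F u) \<subseteq> adjacent_faces r K F"
    proof clarify
      fix u F' assume u: "u \<in> V" "u \<notin> F" and "F' \<in> down_neighbors r K F u"
      then obtain G where "F' = G \<union> {u}" "G \<subseteq> F" "card G = r" "F' \<in> faces r K"
        by (auto simp: down_neighbors_def)
      moreover from this u have "F \<inter> F' = G" by auto
      ultimately show "F' \<in> adjacent_faces r K F" by (simp add: adjacent_faces_def)
    qed
  qed
  moreover have "finite (down_neighbors r K F u)" for u
    by (rule finite_subset[OF _ finite_faces[of r]]) (auto simp: down_neighbors_def)
  \<comment> \<open>A down-neighbour at \<open>u\<close> has all its other vertices in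
    \<open>F\<close>, so it cannot contain another outside vertex \<open>w\<close>.\<close>
  moreover have "down_neighbors r K F u \<inter> down_neighbors r K F w = {}"
    if "u \<in> V - F" "w \<in> V - F" "u \<noteq> w" for u w
    using that by (auto simp: down_neighbors_def)
  ultimately show ?thesis using finite_V by (simp add: card_UN_disjoint)
qed

lemma card_down_neighbors_le_1:
  assumes wheel: "\<not> contains_wheel r V K" and r: "r \<ge> 1"
    and F: "F \<in> faces r K" and u: "u \<in> V - F"
  shows "card (down_neighbors r K F u) \<le> 1"
proof (rule ccontr)
  assume "\<not> ?thesis"
  \<comment> \<open>An infinite set has \<open>card\<close> equal to 0, so the negated bound also
    yields the finiteness required for picking two distinct elements.\<close>
  then obtain X Y where XY: "X \<in> down_neighbors r K F u" "Y \<in> down_neighbors r K F u" "X \<noteq> Y"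
    by (metis One_nat_def card_le_Suc0_iff_eq card.infinite zero_le)
  then obtain G H where G: "X = G \<union> {u}" "G \<subseteq> F" "card G = r" "X \<in> faces r K"
    and H: "Y = H \<union> {u}" "H \<subseteq> F" "card H = r" "Y \<in> faces r K"
    by (auto simp: down_neighbors_def)
  have one_missing: "\<exists>a. a \<in> F \<and> J = F - {a}" if "J \<subseteq> F" "card J = r" for J
  proof -
    have "card (F - J) = 1"
      using that card_face[OF F] finite_face[OF F] by (simp add: card_Diff_subset finite_subset)
    then obtain a where "F - J = {a}" by (auto simp: card_1_singleton_iff)
    then show ?thesis using that by blast
  qed
  from one_missing G obtain a where a: "a \<in> F" "G = F - {a}" by blast
  from one_missing H obtain b where b: "b \<in> F" "H = F - {b}" by blast
  have ab: "a \<noteq> b" using a b G H XY by auto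
  define S where "S = F - {a, b}"
  \<comment> \<open>The rim of the wheel is the cycle \<open>a\<close>, \<open>b\<close>,
    \<open>u\<close>: its consecutive pairs complete \<open>S\<close> to \<open>F\<close>,
    \<open>X\<close> and \<open>Y\<close> respectively.\<close>
  define v where "v j = (if j = 0 then a else if j = 1 then b else u)" for j :: nat
  have "card S = r - 1"
    using card_face[OF F] finite_face[OF F] a b ab by (simp add: S_def card_Diff_subset)
  moreover have "S \<subseteq> V" using face_subset[OF F] by (auto simp: S_def)
  moreover have "inj_on v {..<3}" using ab a b u by (auto simp: inj_on_def v_def)
  moreover have "\<forall>j<3. v j \<in> V - S" using a b u face_subset[OF F] by (auto simp: v_def S_def)
  moreover have "\<forall>j<3. S \<union> {v j, v (Suc j mod 3)} \<in> faces r K"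
  proof -
    have "S \<union> {a, b} = F" "S \<union> {b, u} = X" "S \<union> {u, a} = Y"
      using a b ab G H by (auto simp: S_def)
    then have "S \<union> {a, b} \<in> faces r K" "S \<union> {b, u} \<in> faces r K" "S \<union> {u, a} \<in> faces r K"
      using F G(4) H(4) by metis+
    moreover have "j = 0 \<or> j = 1 \<or> j = 2" if "j < 3" for j :: nat using that by auto
    ultimately show ?thesis by (fastforce simp: v_def)
  qed
  ultimately have "contains_wheel r V K" unfolding contains_wheel_def by blast
  with wheel show False by contradiction
qed

end

section \<open>Row sums and the bound on eigenvalues\<close>

locale wheel_free = complex_on +
  assumes pure: "pure_dim (Suc i) K"
    and no_wheel: "\<not> contains_wheel (Suc i) V K"
begin

text \<open>The left side is the row sum of \<open>B^T B\<close> at \<open>F\<close>. Writing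
  \<open>card V\<close> as \<open>i + 2\<close> plus 1 for each vertex outside \<open>F\<close>
  allows a termwise comparison, in which equal sums force every term to be 1.\<close>

lemma card_adjacent_faces_le:
  assumes F: "F \<in> faces (Suc i) K"
  shows "i + 2 + card (adjacent_faces (Suc i) K F) \<le> card V"
    and "i + 2 + card (adjacent_faces (Suc i) K F) = card V \<longleftrightarrow>
      (\<forall>u\<in>V - F. card (down_neighbors (Suc i) K F u) = 1)"
proof -
  have le: "card (down_neighbors (Suc i) K F u) \<le> 1" if "u \<in> V - F" for u
    using card_down_neighbors_le_1[OF no_wheel _ F that] by simp
  have V: "card V = i + 2 + (\<Sum>u\<in>V - F. 1)"
    using finite_V face_subset[OF F] finite_face[OF F] card_face[OF F] card_mono[of V F]
    by (simp add: card_Diff_subset)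
  show "i + 2 + card (adjacent_faces (Suc i) K F) \<le> card V"
    unfolding V card_adjacent_faces[OF F] using le by (intro add_left_mono sum_mono) auto
  show "i + 2 + card (adjacent_faces (Suc i) K F) = card V \<longleftrightarrow>
      (\<forall>u\<in>V - F. card (down_neighbors (Suc i) K F u) = 1)"
    unfolding V card_adjacent_faces[OF F] add_left_cancel
    using sum_mono_inv[of "\<lambda>u. card (down_neighbors (Suc i) K F u)" "V - F" "\<lambda>_. 1"] le finite_V
    by (metis (no_types, lifting) finite_Diff sum.cong)
qed

text \<open>Passing from \<open>B B\<^sup>T\<close> to \<open>B\<^sup>T B\<close>: \<open>f = B\<^sup>T g\<close> for an eigenvector \<open>g\<close>, which is nonzero because
  \<open>k\<close> is.\<close>

lemma eigenfunction_on_faces: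
  assumes "eigenvalue (incidence_mat i K * transpose_mat (incidence_mat i K)) k" "k \<noteq> 0"
  obtains f where "\<exists>F\<in>faces (Suc i) K. f F \<noteq> 0"
    "\<And>F. F \<in> faces (Suc i) K \<Longrightarrow>
      k * f F = of_nat (i + 2) * f F + (\<Sum>F'\<in>adjacent_faces (Suc i) K F. f F')"
proof -
  from assms obtain g where nz: "\<exists>G\<in>faces i K. g G \<noteq> 0"
    and g: "\<And>G. G \<in> faces i K \<Longrightarrow> (\<Sum>F | F \<in> faces (Suc i) K \<and> G \<subset> F.
        \<Sum>G' | G' \<in> faces i K \<and> G' \<subset> F. g G') = k * g G"
    unfolding eigenvalue_incidence_gram_iff[OF finite_K] by blast
  define f where "f F = (\<Sum>G' | G' \<in> faces i K \<and> G' \<subset> F. g G')" for F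
  note g = g[folded f_def]
  show ?thesis
  proof
    show "\<exists>F\<in>faces (Suc i) K. f F \<noteq> 0"
    proof (rule ccontr)
      assume "\<not> ?thesis"
      \<comment> \<open>If \<open>f\<close> vanished on all faces, the left side of the eigenvalue
        equation for \<open>g\<close> would be a sum of zeros.\<close>
      then have "k * g G = 0" if "G \<in> faces i K" for G
        unfolding g[OF that, symmetric] by (intro sum.neutral) auto
      then show False using nz assms(2) by auto
    qed
    fix F assume F: "F \<in> faces (Suc i) K"
    have "k * f F = (\<Sum>G | G \<in> faces i K \<and> G \<subset> F. k * g G)"
      by (simp add: f_def sum_distrib_left)
    also have "\<dots> = (\<Sum>G | G \<in> faces i K \<and> G \<subset> F. \<Sum>F' | F' \<in> faces (Suc i) K \<and> G \<subset> F'. f F')"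
      by (rule sum.cong) (auto simp: g)
    also note sum_common_subfaces[OF F]
    finally show "k * f F = of_nat (i + 2) * f F + (\<Sum>F'\<in>adjacent_faces (Suc i) K F. f F')" .
  qed
qed

text \<open>Both claims come from the eigenvalue equation at a face where the eigenfunction has
  maximal modulus: a chain of estimates gives the bound, and its collapse gives the equality
  case.\<close>

lemma norm_eigenvalue:
  assumes "eigenvalue (incidence_mat i K * transpose_mat (incidence_mat i K)) k"
  shows "norm k \<le> real (card V)"
    and "norm k = real (card V) \<Longrightarrow> r_path_connected (Suc i) K \<Longrightarrow> one_neighbor_uniform (Suc i) V K"
proof -
  let ?Fs = "faces (Suc i) K" and ?N = "adjacent_faces (Suc i) K" and ?n = "real (card V)"
  have "norm k \<le> ?n \<and>
    (norm k = ?n \<longrightarrow> r_path_connected (Suc i) K \<longrightarrow> one_neighbor_uniform (Suc i) V K)"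
  proof (cases "k = 0")
    case True
    \<comment> \<open>There is no eigenfunction of \<open>B^T B\<close> to pass to when
      \<open>k = 0\<close>. Instead, an existing face makes \<open>V\<close> nonempty, so the
      premise \<open>norm k = ?n\<close> of the second claim fails.\<close>
    obtain F where F: "F \<in> ?Fs" using pure by (auto simp: pure_dim_def)
    then have "F \<noteq> {}" "F \<subseteq> V" using card_face[OF F] face_subset[OF F] by auto
    then have "card V > 0" using finite_V by (auto simp: card_gt_0_iff)
    then show ?thesis using True by simp
  next
    case False
    obtain f where nz: "\<exists>F\<in>?Fs. f F \<noteq> 0"
      and f: "\<And>F. F \<in> ?Fs \<Longrightarrow> k * f F = of_nat (i + 2) * f F + (\<Sum>F'\<in>?N F. f F')"
      using eigenfunction_on_faces[OF assms False] by blast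
    define M where "M = Max ((\<lambda>F. norm (f F)) ` ?Fs)"
    have M_ge: "norm (f F) \<le> M" if "F \<in> ?Fs" for F
      using that finite_faces by (simp add: M_def)
    have "M \<in> (\<lambda>F. norm (f F)) ` ?Fs"
      unfolding M_def using nz finite_faces by (intro Max_in) auto
    then obtain F0 where F0: "F0 \<in> ?Fs" "norm (f F0) = M" by auto
    have M_pos: "M > 0" using nz M_ge by (metis less_le_trans zero_less_norm_iff)
    have N_faces: "?N F \<subseteq> ?Fs" for F by (auto simp: adjacent_faces_def)
    have fin_N: "finite (?N F)" for F using N_faces finite_faces finite_subset by blast
    \<comment> \<open>The links of the chain are the triangle inequality, maximality of
      \<open>M\<close> and the row sum bound. They are stated for every maximizer, because the
      equality case uses them beyond \<open>F0\<close>.\<close>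
    have bound: "norm k * M \<le> real (i + 2) * M + (\<Sum>F'\<in>?N F. norm (f F'))"
      "(\<Sum>F'\<in>?N F. norm (f F')) \<le> (\<Sum>F'\<in>?N F. M)"
      "real (i + 2) * M + (\<Sum>F'\<in>?N F. M) \<le> ?n * M"
      "real (i + 2) * M + (\<Sum>F'\<in>?N F. M) = real (i + 2 + card (?N F)) * M"
      if F: "F \<in> ?Fs" and max: "norm (f F) = M" for F
    proof -
      have "norm k * M = norm (of_nat (i + 2) * f F + (\<Sum>F'\<in>?N F. f F'))"
        unfolding f[OF F, symmetric] norm_mult max ..
      also have "\<dots> \<le> norm (of_nat (i + 2) * f F) + (\<Sum>F'\<in>?N F. norm (f F'))"
        by (rule norm_triangle_le) (intro add_left_mono norm_sum)
      also have "norm (of_nat (i + 2) * f F) = real (i + 2) * M"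
        unfolding norm_mult norm_of_nat max ..
      finally show "norm k * M \<le> real (i + 2) * M + (\<Sum>F'\<in>?N F. norm (f F'))" .
      show "(\<Sum>F'\<in>?N F. norm (f F')) \<le> (\<Sum>F'\<in>?N F. M)"
        using M_ge N_faces by (intro sum_mono) blast
      show eq: "real (i + 2) * M + (\<Sum>F'\<in>?N F. M) = real (i + 2 + card (?N F)) * M"
        by (simp add: algebra_simps)
      show "real (i + 2) * M + (\<Sum>F'\<in>?N F. M) \<le> ?n * M"
        unfolding eq using card_adjacent_faces_le(1)[OF F] M_pos
        by (intro mult_right_mono) (simp_all only: of_nat_le_iff less_imp_le)
    qed
    have le: "norm k \<le> ?n"
    proof -
      have "norm k * M \<le> ?n * M" using bound[OF F0] by linarith
      then show ?thesis using M_pos by simp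
    qed
    have "one_neighbor_uniform (Suc i) V K" if k: "norm k = ?n" and conn: "r_path_connected (Suc i) K"
    proof -
      have spread: "norm (f F') = M" if "F \<in> ?Fs" "norm (f F) = M" "F' \<in> ?N F" for F F'
      proof -
        \<comment> \<open>With \<open>norm k = ?n\<close> the ends of the chain agree, so its middle
          link is an equality; as each summand is at most \<open>M\<close>, each neighbour attains
          \<open>M\<close>.\<close>
        have "(\<Sum>F'\<in>?N F. norm (f F')) = (\<Sum>F'\<in>?N F. M)"
          using bound[OF that(1,2)] unfolding k by linarith
        then show ?thesis
          by (rule sum_mono_inv) (use that M_ge N_faces fin_N in blast)+
      qed
      have all_max: "norm (f F) = M" if F: "F \<in> ?Fs" for F
      proof -
        from conn F0 F obtain Fs where Fs: "r_path (Suc i) K Fs" "hd Fs = F0" "last Fs = F"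
          unfolding r_path_connected_def by blast
        then have ne: "Fs \<noteq> []" and sub: "set Fs \<subseteq> ?Fs" by (auto simp: r_path_def)
        have "norm (f (Fs ! j)) = M" if "j < length Fs" for j
          using that
        proof (induction j)
          case 0
          then show ?case using Fs F0 ne by (simp add: hd_conv_nth)
        next
          case (Suc j)
          \<comment> \<open>Consecutive faces of the path meet in an \<open>i\<close>-face, of size
            \<open>Suc i\<close>, which is exactly adjacency; maximality thus travels along the path
            from \<open>F0\<close>.\<close>
          have "Fs ! j \<inter> Fs ! Suc j \<in> faces i K"
            using Fs(1) Suc.prems unfolding r_path_def by force
          then have "Fs ! Suc j \<in> ?N (Fs ! j)"
            using sub Suc.prems by (auto simp: adjacent_faces_def card_face)
          then show ?case using spread[of "Fs ! j"] Suc sub nth_mem[of j Fs] by fastforce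
        qed
        from this[of "length Fs - 1"] show ?thesis using Fs ne by (simp add: last_conv_nth)
      qed
      show ?thesis
        unfolding one_neighbor_uniform_def
      proof
        fix F assume F: "F \<in> ?Fs"
        \<comment> \<open>Every face is now a maximizer, so the last link of the chain is also an
          equality at each of them.\<close>
        have "?n * M = real (i + 2 + card (?N F)) * M"
          using bound[OF F all_max[OF F]] unfolding k by linarith
        then have "i + 2 + card (?N F) = card V" using M_pos by simp
        then show "\<forall>u\<in>V - F. card (down_neighbors (Suc i) K F u) = 1"
          using card_adjacent_faces_le(2)[OF F] by blast
      qed
    qed
    with le show ?thesis by blast
  qed
  then show "norm k \<le> ?n"
    and "norm k = ?n \<Longrightarrow> r_path_connected (Suc i) K \<Longrightarrow> one_neighbor_uniform (Suc i) V K"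
    by blast+
qed

section \<open>Attainment of \<open>n\<close> and of the spectral radius\<close>

text \<open>Provides a face at which the eigenfunction for \<open>n\<close> is nonzero, and shows
  that \<open>B B^T\<close> has positive dimension.\<close>

lemma subface_exists:
  obtains F G where "F \<in> faces (Suc i) K" "G \<in> faces i K" "G \<subset> F"
proof -
  obtain F where F: "F \<in> faces (Suc i) K" using pure by (auto simp: pure_dim_def)
  then obtain G where G: "G \<subseteq> F" "card G = i + 1"
    using obtain_subset_with_card_n[of "i + 1" F] card_face[OF F]
    by (metis add.commute le_add2 plus_1_eq_Suc)
  have "G \<in> faces i K" using F G by (rule subset_face)
  moreover have "G \<subset> F" using G card_face[OF F] by auto
  ultimately show ?thesis using F that by blast
qed

text \<open>Uniformity makes all row sums of \<open>B^T B\<close> equal to \<open>n\<close>, so the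
  constant function 1 is an eigenfunction there; its image \<open>g = B 1\<close>, the degree
  function of \<open>i\<close>-faces, is one for \<open>B B^T\<close>.\<close>

lemma eigenvalue_card_V:
  assumes "one_neighbor_uniform (Suc i) V K"
  shows "eigenvalue (incidence_mat i K * transpose_mat (incidence_mat i K)) (of_nat (card V))"
proof -
  define g :: "'a set \<Rightarrow> complex" where "g G = (\<Sum>F | F \<in> faces (Suc i) K \<and> G \<subset> F. 1)" for G
  have sum_g: "(\<Sum>G | G \<in> faces i K \<and> G \<subset> F. g G) = of_nat (card V)"
    if F: "F \<in> faces (Suc i) K" for F
  proof -
    have "i + 2 + card (adjacent_faces (Suc i) K F) = card V"
      using card_adjacent_faces_le(2)[OF F] assms F by (simp add: one_neighbor_uniform_def)
    then have "of_nat (card V) = of_nat (i + 2) * 1 + (\<Sum>F'\<in>adjacent_faces (Suc i) K F. 1 :: complex)"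
      by (metis mult.right_neutral of_nat_add sum_constant)
    then show ?thesis unfolding g_def sum_common_subfaces[OF F] by simp
  qed
  obtain F G where FG: "F \<in> faces (Suc i) K" "G \<in> faces i K" "G \<subset> F" by (rule subface_exists)
  then have "g G \<noteq> 0" using finite_faces by (auto simp: g_def)
  moreover have "(\<Sum>F | F \<in> faces (Suc i) K \<and> G \<subset> F. \<Sum>G' | G' \<in> faces i K \<and> G' \<subset> F. g G') =
      of_nat (card V) * g G" for G
    by (simp add: sum_g) (simp add: g_def)
  ultimately show ?thesis
    unfolding eigenvalue_incidence_gram_iff[OF finite_K] using FG by blast
qed

text \<open>In positive dimension the complex spectrum is nonempty and finite, so the spectral
  radius is a maximum of moduli.\<close>

lemma signless_radius_attained:
  obtains k where "eigenvalue (incidence_mat i K * transpose_mat (incidence_mat i K)) k"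
    "signless_radius i K = norm k"
  and "\<And>k'. eigenvalue (incidence_mat i K * transpose_mat (incidence_mat i K)) k' \<Longrightarrow>
    norm k' \<le> signless_radius i K"
proof -
  let ?A = "incidence_mat i K * transpose_mat (incidence_mat i K)"
  have A: "?A \<in> carrier_mat (card (faces i K)) (card (faces i K))"
    by (simp add: incidence_mat_def carrier_matI)
  have pos: "card (faces i K) > 0"
    using subface_exists finite_faces by (metis card_gt_0_iff empty_iff)
  show ?thesis
    using spectral_radius_mem_max[OF A pos] that unfolding signless_radius_def spectrum_def by blast
qed

end

theorem theorem3p6:
  fixes V :: "'a set" and K :: "'a set set" and r n :: nat
  assumes "simplicial_complex V K"
    and "card V = n"
    and "r \<ge> 1"
    and "pure_dim r K"
    and "\<not> contains_wheel r V K"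
  shows "signless_radius (r - 1) K \<le> real n \<and>
    (r_path_connected r K \<longrightarrow>
      (signless_radius (r - 1) K = real n \<longleftrightarrow> one_neighbor_uniform r V K))"
proof -
  obtain i where r: "r = Suc i" using assms(3) by (cases r) auto
  interpret wheel_free V K i using assms r by unfold_locales auto
  obtain k where k: "eigenvalue (incidence_mat i K * transpose_mat (incidence_mat i K)) k"
      "signless_radius i K = norm k"
    and max: "\<And>k'. eigenvalue (incidence_mat i K * transpose_mat (incidence_mat i K)) k' \<Longrightarrow>
      norm k' \<le> signless_radius i K"
    by (rule signless_radius_attained) blast
  have le: "signless_radius i K \<le> real n" using norm_eigenvalue(1)[OF k(1)] k(2) assms(2) by simp
  \<comment> \<open>Here \<open>n\<close> itself is an eigenvalue, so maximality of the radius gives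
    the reverse inequality. The converse direction applies the equality case to the eigenvalue
    \<open>k\<close> attaining the radius.\<close>
  moreover have "signless_radius i K = real n" if "one_neighbor_uniform (Suc i) V K"
    using max[OF eigenvalue_card_V[OF that]] le assms(2) by simp
  ultimately show ?thesis using norm_eigenvalue(2)[OF k(1)] k(2) assms(2) r by auto
qed

end
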